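(* For each $n$ let $\mathbf{d}=\mathbf{d}(n)=(d_1,\dots,d_n)$ be a tuple of positive integers with $d_i<n$ for all $i$ and with $d_1+\cdots+d_n$ even. Put $p_j=p_j(n)=\frac1n|\{i\in[n]: d_i=j\}|$ for $1\le j\le n-1$ and $$\nu=\nu(n)=\frac{\sum_{i\in[n]} d_i(d_i-1)}{\sum_{i\in[n]} d_i}.$$ Suppose that there are constants $c>0$ and $\gamma>3$, not depending on $n$ or $j$, such that $$p_j(n)\le c\,j^{-\gamma}\qquad\text{for all } n \text{ and all } 1\le j\le n-1,$$ and suppose that $\limsup_{n\to\infty}\nu(n)<1$. Let $C_n$ denote the size (number of vertices) of the largest connected component of the uniformly random graph $G_{n,\mathbf{d}}$ on $[n]$ with degree sequence $\mathbf{d}$. Then for every $\lambda=\lambda(n)$ with $\lambda(n)\to\infty$ as $n\to\infty$, however slowly, $$\lim_{n\to\infty}\mathrm{P}\{C_n\le \lambda(n)\, n^{1/\gamma}\ln n\}=1 .$$ In short, $C_n=O_P(n^{1/\gamma}\ln n)$.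
   Context: $[n]=\{1,\dots,n\}$. $\mathcal{G}_{n,\mathbf{d}}$ is the set of all simple graphs (no loops, no multiple edges) on the labelled vertex set $[n]$ in which vertex $i$ has degree $d_i$ for every $i\in[n]$. $G_{n,\mathbf{d}}$ is a random element of $\mathcal{G}_{n,\mathbf{d}}$ with the uniform distribution; it is defined whenever $\mathcal{G}_{n,\mathbf{d}}\neq\emptyset$, which under the hypotheses is the case for all sufficiently large $n$. $\mathrm{P}$ is the corresponding probability. $C_n=O_P(a_n)$ means that $C_n/a_n$ is bounded in probability. *)

theory Defs
  imports "HOL-Probability.Probability"
begin

text \<open>A simple graph on a fixed vertex set is identified with its edge set, a set of
  two-element sets of vertices.\<close>

definition simple_graphs_on :: "'a set \<Rightarrow> 'a set set set" where
  "simple_graphs_on V = {E. \<forall>e\<in>E. e \<subseteq> V \<and> card e = 2}"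

definition degree_of :: "'a set set \<Rightarrow> 'a \<Rightarrow> nat" where
  "degree_of E v = card {e \<in> E. v \<in> e}"

definition graphs_with_degrees :: "nat \<Rightarrow> (nat \<Rightarrow> nat) \<Rightarrow> nat set set set" where
  "graphs_with_degrees n d = {E \<in> simple_graphs_on {1..n}. \<forall>i\<in>{1..n}. degree_of E i = d i}"

definition component_of_vertex :: "'a set \<Rightarrow> 'a set set \<Rightarrow> 'a \<Rightarrow> 'a set" where
  "component_of_vertex V E v = {w \<in> V. (v, w) \<in> {(x, y). {x, y} \<in> E}\<^sup>*}"

definition largest_component_size :: "'a set \<Rightarrow> 'a set set \<Rightarrow> nat" where
  "largest_component_size V E = Max (card ` component_of_vertex V E ` V)"

text \<open>If no graph has the given degrees, the space below is empty and every event has measure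
  \<open>0\<close>. So convergence of probabilities to \<open>1\<close> also asserts that such graphs
  exist for all large \<open>n\<close>.\<close>

definition random_graph :: "nat \<Rightarrow> (nat \<Rightarrow> nat) \<Rightarrow> nat set set measure" where
  "random_graph n d = uniform_count_measure (graphs_with_degrees n d)"

definition degree_proportion :: "nat \<Rightarrow> (nat \<Rightarrow> nat) \<Rightarrow> nat \<Rightarrow> real" where
  "degree_proportion n d j = real (card {i \<in> {1..n}. d i = j}) / real n"

text \<open>At \<open>d i = 0\<close> the truncated subtraction is harmless because of the factor \<open>d i\<close>.\<close>

definition degree_ratio :: "nat \<Rightarrow> (nat \<Rightarrow> nat) \<Rightarrow> real" where
  "degree_ratio n d = real (\<Sum>i\<in>{1..n}. d i * (d i - 1)) / real (\<Sum>i\<in>{1..n}. d i)"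

text \<open>\<open>X n = O\<^sub>P (a n)\<close>: the ratio \<open>X n / a n\<close> is bounded in probability
  as \<open>n\<close> tends to infinity.\<close>

definition bigO_in_prob :: "(nat \<Rightarrow> 'a measure) \<Rightarrow> (nat \<Rightarrow> 'a \<Rightarrow> real) \<Rightarrow> (nat \<Rightarrow> real) \<Rightarrow> bool" where
  "bigO_in_prob M X a \<longleftrightarrow>
     (\<forall>\<epsilon>>0. \<exists>K. \<forall>\<^sub>F n in sequentially. \<P>(x in M n. \<bar>X n x / a n\<bar> \<le> K) > 1 - \<epsilon>)"

end

theory Submission
  imports Defs "HOL-Real_Asymp.Real_Asymp"
begin

text \<open>
  The component of a vertex \<open>v\<close> is explored one edge at a time inside the space of simple
  graphs itself. If \<open>F\<close> is the set of edges revealed so far, then the conditional law is uniform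
  on the graphs with degrees \<open>D\<close> that contain \<open>F\<close>; call this set \<open>extensions V D F\<close>. So every
  probability below is a ratio of cardinalities of such sets. Let \<open>r\<^sub>i\<close> be the number of edges
  at \<open>i\<close> that are still to be revealed. Revealing a uniformly chosen hidden edge at \<open>u\<close> leads to
  \<open>w\<close> with probability \<open>card (extensions V D (insert {u, w} F)) / (r\<^sub>u * card (extensions V D F))\<close>.

  Replacing the edges \<open>uw\<close> and \<open>xy\<close> by \<open>ux\<close> and \<open>wy\<close> keeps all degrees. Counting these
  moves in both directions (lemma \<open>switching\<close>) bounds that probability by \<open>r\<^sub>w / L\<close>, where
  \<open>L\<close> is the sum of the degrees minus twice the number of revealed edges minus
  \<open>2 * \<Delta> * (\<Delta> + 1)\<close>, with \<open>\<Delta>\<close> the maximum degree: the bound that independent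
  matching of half-edges would give, up to the error in \<open>L\<close>. One revealed edge
  removes one half-edge at \<open>u\<close> from the boundary of the explored part and adds at most
  \<open>D w - 1\<close> at \<open>w\<close>, and the mean of the latter is about \<open>\<nu> < 1\<close>. Hence the number \<open>H\<close>
  of boundary half-edges drifts downwards, and for \<open>\<theta>\<close> of order \<open>1 / \<Delta>\<close> the expectation of
  \<open>exp (\<theta> * H)\<close> shrinks by a factor \<open>exp (- \<theta> * \<delta>)\<close> per step. The exploration is still alive
  after \<open>k\<close> steps with probability at most \<open>exp (\<theta> * D v - \<theta> * \<delta> * k)\<close>
  (lemmas \<open>exploration\<close> and \<open>decay_bound\<close>). For \<open>k\<close> a large multiple of
  \<open>\<Delta> * ln n\<close> this is \<open>O(1 / n\<^sup>2)\<close>, which beats a union bound over \<open>v\<close>.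

  The power law gives \<open>\<Delta> = O(n powr (1 / \<gamma>))\<close>, because a degree that occurs has proportion
  at least \<open>1 / n\<close>. Since \<open>\<gamma> > 3\<close>, both \<open>\<Delta>\<^sup>2\<close> and \<open>k\<close> are \<open>o(n)\<close>, so
  all corrections to \<open>L\<close> are negligible. The same switching, applied to a maximal graph whose
  degrees do not exceed \<open>D\<close>, shows that graphs with the given degrees exist
  (lemma \<open>extensions_nonempty\<close>).
\<close>

section \<open>Simple graphs, degrees and neighbours\<close>

definition extensions :: "'a set \<Rightarrow> ('a \<Rightarrow> nat) \<Rightarrow> 'a set set \<Rightarrow> 'a set set set" where
  "extensions V D F = {E \<in> simple_graphs_on V. (\<forall>i\<in>V. degree_of E i = D i) \<and> F \<subseteq> E}"

definition neighbours :: "'a set set \<Rightarrow> 'a \<Rightarrow> 'a set" where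
  "neighbours E u = {y. {u, y} \<in> E}"

lemma simple_graphs_on_subset: "E \<in> simple_graphs_on V \<Longrightarrow> F \<subseteq> E \<Longrightarrow> F \<in> simple_graphs_on V"
  by (auto simp: simple_graphs_on_def)

lemma finite_simple_graphs_on: "finite V \<Longrightarrow> finite (simple_graphs_on V)"
  by (rule finite_subset[of _ "Pow (Pow V)"]) (auto simp: simple_graphs_on_def)

lemma simple_graph_finite: "finite V \<Longrightarrow> E \<in> simple_graphs_on V \<Longrightarrow> finite E"
  by (rule finite_subset[of _ "Pow V"]) (auto simp: simple_graphs_on_def)

lemma finite_extensions: "finite V \<Longrightarrow> finite (extensions V D F)"
  by (rule finite_subset[OF _ finite_simple_graphs_on]) (auto simp: extensions_def)

lemma simple_graph_edge:
  assumes "E \<in> simple_graphs_on V" "{x, y} \<in> E"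
  shows "x \<in> V" "y \<in> V" "x \<noteq> y"
  using assms by (auto simp: simple_graphs_on_def)

lemma neighbours_subset: "E \<in> simple_graphs_on V \<Longrightarrow> neighbours E u \<subseteq> V"
  by (auto simp: neighbours_def dest: simple_graph_edge)

lemma card_neighbours:
  assumes "E \<in> simple_graphs_on V"
  shows "card (neighbours E u) = degree_of E u"
proof -
  have "bij_betw (\<lambda>y. {u, y}) (neighbours E u) {e \<in> E. u \<in> e}"
  proof (rule bij_betwI')
    fix x y show "({u, x} = {u, y}) = (x = y)"
      by (auto simp: doubleton_eq_iff)
  next
    fix x assume "x \<in> neighbours E u" then show "{u, x} \<in> {e \<in> E. u \<in> e}"
      by (auto simp: neighbours_def)
  next
    fix e assume e: "e \<in> {e \<in> E. u \<in> e}"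
    with assms have "card e = 2" by (auto simp: simple_graphs_on_def)
    then obtain a b where "e = {a, b}" by (auto simp: card_2_iff)
    with e have "\<exists>y. e = {u, y}" by auto
    with e show "\<exists>x\<in>neighbours E u. e = {u, x}" by (auto simp: neighbours_def)
  qed
  then show ?thesis by (simp add: bij_betw_same_card degree_of_def)
qed

lemma degree_of_eq_sum: "finite E \<Longrightarrow> degree_of E i = (\<Sum>e\<in>E. of_bool (i \<in> e))"
  unfolding degree_of_def by (simp add: Int_def)

lemma degree_of_mono: "finite E \<Longrightarrow> F \<subseteq> E \<Longrightarrow> degree_of F i \<le> degree_of E i"
  unfolding degree_of_def by (rule card_mono) auto

lemma degree_of_Diff:
  assumes "finite E" "F \<subseteq> E"
  shows "degree_of (E - F) i = degree_of E i - degree_of F i"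
proof -
  have "{e \<in> E - F. i \<in> e} = {e \<in> E. i \<in> e} - {e \<in> F. i \<in> e}" by auto
  then show ?thesis unfolding degree_of_def using assms
    by (simp add: card_Diff_subset finite_subset Collect_mono_iff subset_iff)
qed

lemma degree_of_insert:
  "finite F \<Longrightarrow> e \<notin> F \<Longrightarrow> degree_of (insert e F) i = degree_of F i + of_bool (i \<in> e)"
  by (simp add: degree_of_eq_sum)

lemma degree_of_remove:
  "finite F \<Longrightarrow> e \<in> F \<Longrightarrow> degree_of F i = degree_of (F - {e}) i + of_bool (i \<in> e)"
  by (simp add: degree_of_eq_sum sum.remove del: sum_of_bool_eq)

lemma handshake:
  assumes "finite V" "E \<in> simple_graphs_on V"
  shows "(\<Sum>i\<in>V. degree_of E i) = 2 * card E"
proof -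
  have fE: "finite E" using assms by (rule simple_graph_finite)
  have "(\<Sum>i\<in>V. degree_of E i) = (\<Sum>e\<in>E. \<Sum>i\<in>V. of_bool (i \<in> e))"
    using fE by (simp add: degree_of_eq_sum sum.swap[of _ E V] del: sum_of_bool_eq)
  also have "\<dots> = (\<Sum>e\<in>E. 2)"
  proof (rule sum.cong)
    fix e assume "e \<in> E"
    with assms have "V \<inter> e = e" "card e = 2" by (auto simp: simple_graphs_on_def)
    then show "(\<Sum>i\<in>V. of_bool (i \<in> e)) = (2::nat)" using assms(1) by simp
  qed simp
  finally show ?thesis by simp
qed

section \<open>Edge switching\<close>

text \<open>A switching at \<open>u\<close> and \<open>w\<close> needs an oriented edge whose first end can be joined to \<open>u\<close>
  and whose second end can be joined to \<open>w\<close>. Each of the two requirements excludes only the edges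
  that start in a closed neighbourhood, which are at most \<open>\<Delta> * (\<Delta> + 1)\<close>.\<close>

lemma card_far_pairs:
  assumes V: "finite V" and E: "E \<in> simple_graphs_on V" and H: "H \<subseteq> E"
    and deg: "\<And>i. i \<in> V \<Longrightarrow> degree_of E i \<le> \<Delta>"
    and uw: "u \<in> V" "w \<in> V"
  shows "2 * card H \<le>
    card {(x, y). {x, y} \<in> H \<and> x \<notin> insert u (neighbours E u) \<and> y \<notin> insert w (neighbours E w)}
      + 2 * (\<Delta> * (\<Delta> + 1))"
proof -
  let ?N = "\<lambda>u. insert u (neighbours E u)"
  let ?P = "{(x, y). {x, y} \<in> H}"
  let ?good = "{(x, y). {x, y} \<in> H \<and> x \<notin> ?N u \<and> y \<notin> ?N w}"
  let ?B1 = "SIGMA x:?N u. neighbours H x"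
  let ?B2 = "SIGMA y:?N w. neighbours H y"
  have HS: "H \<in> simple_graphs_on V" using E H by (rule simple_graphs_on_subset)
  have fN: "finite (neighbours G x)" if "G \<in> simple_graphs_on V" for G x
    using neighbours_subset[OF that] V by (rule finite_subset)
  have P: "?P = (SIGMA x:V. neighbours H x)"
    using HS by (auto simp: neighbours_def dest: simple_graph_edge)
  have cP: "card ?P = 2 * card H"
    unfolding P using V fN[OF HS] by (simp add: card_neighbours[OF HS] handshake[OF V HS])
  have B: "card (SIGMA x:?N z. neighbours H x) \<le> \<Delta> * (\<Delta> + 1)" if z: "z \<in> V" for z
  proof -
    have sub: "?N z \<subseteq> V" using neighbours_subset[OF E] z by auto
    have "card (?N z) \<le> \<Delta> + 1"
      using card_insert_le_m1[of "\<Delta> + 1" "neighbours E z" z] deg[OF z] card_neighbours[OF E, of z]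
      by simp
    moreover have "card (SIGMA x:?N z. neighbours H x) = (\<Sum>x\<in>?N z. degree_of H x)"
      using fN[OF HS] fN[OF E] by (subst card_SigmaI) (auto simp: card_neighbours[OF HS])
    moreover have "\<dots> \<le> of_nat (card (?N z)) * \<Delta>"
    proof (rule sum_bounded_above)
      fix x assume "x \<in> ?N z"
      then have "degree_of E x \<le> \<Delta>" using sub deg by auto
      then show "degree_of H x \<le> \<Delta>"
        using degree_of_mono[OF simple_graph_finite[OF V E] H, of x] by simp
    qed
    ultimately show ?thesis
      by (metis (no_types, lifting) le_trans mult.commute mult_le_mono1 of_nat_id)
  qed
  have fB: "finite (SIGMA x:?N z. neighbours H x)" for z
    using fN[OF HS] fN[OF E] by auto
  have "?P \<subseteq> ?good \<union> (?B1 \<union> prod.swap ` ?B2)"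
    by (auto simp: neighbours_def insert_commute image_iff)
  moreover have fg: "finite ?good"
    by (rule finite_subset[of _ "V \<times> V"]) (use V HS in \<open>auto dest: simple_graph_edge\<close>)
  ultimately have "card ?P \<le> card (?good \<union> (?B1 \<union> prod.swap ` ?B2))"
    using fB by (intro card_mono) auto
  also have "\<dots> \<le> card ?good + (card ?B1 + card (prod.swap ` ?B2))"
    by (meson add_left_mono card_Un_le le_trans)
  also have "\<dots> \<le> card ?good + (\<Delta> * (\<Delta> + 1) + \<Delta> * (\<Delta> + 1))"
    using B[OF uw(1)] B[OF uw(2)] card_image_le[OF fB[of w], of prod.swap] by (intro add_mono) auto
  finally show ?thesis unfolding cP by simp
qed

text \<open>Each end of the removed edge \<open>xy\<close> receives one of the new edges, so only \<open>u\<close> and \<open>w\<close> gain. The case \<open>u = w\<close>, where \<open>u\<close> gains two edges, serves the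
  existence proof.\<close>

lemma degree_of_switch:
  assumes fin: "finite E" and e: "{x, y} \<in> E" "x \<noteq> y" and new: "{u, x} \<notin> E" "{w, y} \<notin> E"
    and ne: "x \<noteq> u" "y \<noteq> w" "{u, x} \<noteq> {w, y}"
  shows "degree_of (insert {u, x} (insert {w, y} (E - {{x, y}}))) i
    = degree_of E i + of_bool (i = u) + of_bool (i = w)"
proof -
  have "degree_of (insert {u, x} (insert {w, y} (E - {{x, y}}))) i
    = degree_of (E - {{x, y}}) i + of_bool (i \<in> {w, y}) + of_bool (i \<in> {u, x})"
    using fin new ne by (subst degree_of_insert, simp, simp, subst degree_of_insert) auto
  moreover have "degree_of E i = degree_of (E - {{x, y}}) i + of_bool (i \<in> {x, y})"
    using fin e by (intro degree_of_remove) auto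
  ultimately show ?thesis using ne e by (auto split: if_splits)
qed

text \<open>In terms of the conditional law given \<open>F\<close>, this bounds the probability of the edge \<open>uw\<close>. A graph
  with that edge is sent to one with \<open>ux\<close> and \<open>wy\<close> in place of \<open>uw\<close> and a far hidden edge
  \<open>xy\<close>. The image together with \<open>(x, y)\<close> determines the graph, and in the image \<open>x\<close> and
  \<open>y\<close> are hidden neighbours of \<open>u\<close> and \<open>w\<close>, so each image arises at most
  \<open>(D u - degree_of F u) * (D w - degree_of F w)\<close> times. The error term is on the right-hand
  side to avoid a truncated difference.\<close>

lemma switching:
  assumes V: "finite V" and uw: "u \<in> V" "w \<in> V" "u \<noteq> w" "{u, w} \<notin> F"
    and deg: "\<And>i. i \<in> V \<Longrightarrow> D i \<le> \<Delta>"
  shows "card (extensions V D (insert {u, w} F)) * (\<Sum>i\<in>V. D i)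
    \<le> card (extensions V D (insert {u, w} F)) * (2 * card F + 2 * (\<Delta> * (\<Delta> + 1)))
      + card (extensions V D F) * ((D u - degree_of F u) * (D w - degree_of F w))"
proof -
  let ?X = "extensions V D (insert {u, w} F)" and ?Y = "extensions V D F"
  define good where "good = (\<lambda>E. {(x, y). {x, y} \<in> E - F \<and> x \<notin> insert u (neighbours E u)
      \<and> y \<notin> insert w (neighbours E w)})"
  define sw where "sw = (\<lambda>E x y. insert {u, x} (insert {w, y} ((E - {{u, w}}) - {{x, y}})))"
  let ?f = "\<lambda>(E, x, y). (sw E x y, x, y)"
  let ?T = "SIGMA E:?Y. neighbours (E - F) u \<times> neighbours (E - F) w"
  have fX: "finite ?X" and fY: "finite ?Y" using V by (auto intro: finite_extensions)
  have goodD: "sw E x y \<in> ?Y" "x \<in> neighbours (sw E x y - F) u" "y \<in> neighbours (sw E x y - F) w"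
    "E = insert {u, w} (insert {x, y} (sw E x y - {{u, x}, {w, y}}))"
    if E: "E \<in> ?X" and xy: "(x, y) \<in> good E" for E x y
  proof -
    have ES: "E \<in> simple_graphs_on V" and EF: "insert {u, w} F \<subseteq> E"
      and ED: "\<And>i. i \<in> V \<Longrightarrow> degree_of E i = D i"
      using E by (auto simp: extensions_def)
    have fE: "finite E" using V ES by (rule simple_graph_finite)
    have e: "{x, y} \<in> E" "{x, y} \<notin> F" "{u, x} \<notin> E" "{w, y} \<notin> E" "x \<noteq> u" "y \<noteq> w"
      using xy by (auto simp: good_def neighbours_def)
    (* u and w are adjacent in E, so each lies in the excluded neighbourhood of the other *)
    have n1: "x \<noteq> w" using e EF by auto
    have n2: "y \<noteq> u" using e EF by (auto simp: insert_commute)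
    have n3: "x \<noteq> y" "x \<in> V" "y \<in> V" using simple_graph_edge[OF ES e(1)] by auto
    have ne: "{u, x} \<noteq> {w, y}" "{u, w} \<noteq> {x, y}" "{u, w} \<noteq> {u, x}" "{u, w} \<noteq> {w, y}"
      "{x, y} \<noteq> {u, x}" "{x, y} \<noteq> {w, y}"
      using uw e n1 n2 n3 by (auto simp: doubleton_eq_iff)
    have "degree_of (sw E x y) i = degree_of (E - {{u, w}}) i + of_bool (i = u) + of_bool (i = w)" for i
      unfolding sw_def using fE e ne n3 by (intro degree_of_switch) auto
    moreover have "degree_of E i = degree_of (E - {{u, w}}) i + of_bool (i \<in> {u, w})" for i
      using fE EF by (intro degree_of_remove) auto
    ultimately have "degree_of (sw E x y) i = D i" if "i \<in> V" for i
      using ED[OF that] uw by (auto split: if_splits)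
    moreover have "sw E x y \<in> simple_graphs_on V"
      using ES uw e n3 by (auto simp: sw_def simple_graphs_on_def)
    moreover have "F \<subseteq> sw E x y" using EF e uw by (auto simp: sw_def)
    ultimately show "sw E x y \<in> ?Y" by (auto simp: extensions_def)
    show "x \<in> neighbours (sw E x y - F) u" "y \<in> neighbours (sw E x y - F) w"
      using e EF by (auto simp: neighbours_def sw_def)
    show "E = insert {u, w} (insert {x, y} (sw E x y - {{u, x}, {w, y}}))"
      unfolding sw_def using e EF ne by auto
  qed
  have inj: "inj_on ?f (Sigma ?X good)"
  proof (rule inj_onI, clarify)
    fix E x y E' 
    assume "E \<in> ?X" "(x, y) \<in> good E" "E' \<in> ?X" "(x, y) \<in> good E'" "sw E x y = sw E' x y"
    then show "E = E' \<and> (x, y) = (x, y)" using goodD(4)[of E x y] goodD(4)[of E' x y] by simp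
  qed
  have img: "?f ` Sigma ?X good \<subseteq> ?T" using goodD(1-3) by force
  have ESF: "E - F \<in> simple_graphs_on V" if "E \<in> ?Y" for E
    using that by (auto simp: extensions_def intro: simple_graphs_on_subset)
  have fT: "finite ?T"
    using fY V ESF by (intro finite_SigmaI) (auto intro: finite_subset[OF neighbours_subset])
  have degT: "card (neighbours (E - F) z) = D z - degree_of F z" if "E \<in> ?Y" "z \<in> V" for E z
  proof -
    have "finite E" using that V by (auto simp: extensions_def intro: simple_graph_finite)
    then show ?thesis using that card_neighbours[OF ESF[OF that(1)]]
      by (simp add: degree_of_Diff extensions_def)
  qed
  have "card (Sigma ?X good) \<le> card ?T" using inj img fT by (rule card_inj_on_le)
  also have "\<dots> = (\<Sum>E\<in>?Y. (D u - degree_of F u) * (D w - degree_of F w))"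
    using fY V ESF uw by (subst card_SigmaI)
      (auto intro: finite_subset[OF neighbours_subset] simp: card_cartesian_product degT)
  finally have 1: "card (Sigma ?X good) \<le> card ?Y * ((D u - degree_of F u) * (D w - degree_of F w))"
    by simp
  have fgood: "finite (good E)" if "E \<in> ?X" for E
    by (rule finite_subset[of _ "V \<times> V"])
      (use V that in \<open>auto simp: good_def extensions_def dest: simple_graph_edge\<close>)
  have "card ?X * (\<Sum>i\<in>V. D i) = (\<Sum>E\<in>?X. (\<Sum>i\<in>V. D i))" by simp
  also have "\<dots> \<le> (\<Sum>E\<in>?X. card (good E) + (2 * card F + 2 * (\<Delta> * (\<Delta> + 1))))"
  proof (rule sum_mono)
    fix E assume E: "E \<in> ?X"
    have ES: "E \<in> simple_graphs_on V" and EF: "F \<subseteq> E"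
      and ED: "\<And>i. i \<in> V \<Longrightarrow> degree_of E i = D i"
      using E by (auto simp: extensions_def)
    have fE: "finite E" using V ES by (rule simple_graph_finite)
    have "(\<Sum>i\<in>V. D i) = 2 * card E" using handshake[OF V ES] ED by simp
    moreover have "card E = card (E - F) + card F"
      using EF fE by (metis card_Diff_subset card_mono finite_subset le_add_diff_inverse2)
    moreover have "2 * card (E - F) \<le> card (good E) + 2 * (\<Delta> * (\<Delta> + 1))"
      unfolding good_def using card_far_pairs[OF V ES, of "E - F" \<Delta> u w] ED deg uw by auto
    ultimately show "(\<Sum>i\<in>V. D i) \<le> card (good E) + (2 * card F + 2 * (\<Delta> * (\<Delta> + 1)))" by simp
  qed
  also have "\<dots> = card (Sigma ?X good) + card ?X * (2 * card F + 2 * (\<Delta> * (\<Delta> + 1)))"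
    using fX fgood by (simp add: sum.distrib card_SigmaI)
  finally show ?thesis using 1 by linarith
qed

section \<open>Existence of graphs with given degrees\<close>

text \<open>Take a graph with degrees at most \<open>D\<close> and as many edges as possible. Its deficient vertices
  are pairwise adjacent, so there are at most \<open>\<Delta> + 1\<close> of them and their total
  deficit is at most \<open>\<Delta> * (\<Delta> + 1)\<close>. There is then an edge \<open>xy\<close> far from two deficient vertices \<open>u\<close> and \<open>w\<close>,
  and trading it for \<open>ux\<close> and \<open>wy\<close> gains an edge. If only one vertex is deficient, parity
  makes its deficit at least \<open>2\<close>, and \<open>w = u\<close> works.\<close>

lemma extensions_nonempty:
  assumes V: "finite V" and even: "even (\<Sum>i\<in>V. D i)" and deg: "\<And>i. i \<in> V \<Longrightarrow> D i \<le> \<Delta>"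
    and large: "3 * (\<Delta> * (\<Delta> + 1)) < (\<Sum>i\<in>V. D i)"
  shows "extensions V D {} \<noteq> {}"
proof -
  define \<G> where "\<G> = {E \<in> simple_graphs_on V. \<forall>i\<in>V. degree_of E i \<le> D i}"
  have "{} \<in> \<G>" by (auto simp: \<G>_def simple_graphs_on_def degree_of_def)
  moreover have "finite \<G>" using finite_simple_graphs_on[OF V] by (simp add: \<G>_def)
  ultimately have "Max (card ` \<G>) \<in> card ` \<G>" by (intro Max_in) auto
  then obtain E where E: "E \<in> \<G>" "card E = Max (card ` \<G>)" by auto
  have Emax: "card E' \<le> card E" if "E' \<in> \<G>" for E'
    unfolding E(2) using that \<open>finite \<G>\<close> by simp
  have ES: "E \<in> simple_graphs_on V" and ED: "\<And>i. i \<in> V \<Longrightarrow> degree_of E i \<le> D i"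
    using E by (auto simp: \<G>_def)
  have fE: "finite E" using V ES by (rule simple_graph_finite)
  define Def where "Def = {i \<in> V. degree_of E i < D i}"
  have Def_clique: "{u, w} \<in> E" if "u \<in> Def" "w \<in> Def" "u \<noteq> w" for u w
  proof (rule ccontr)
    assume n: "{u, w} \<notin> E"
    have "degree_of (insert {u, w} E) i \<le> D i" if "i \<in> V" for i
      using \<open>u \<in> Def\<close> \<open>w \<in> Def\<close> degree_of_insert[OF fE n, of i] ED[OF that] by (auto simp: Def_def)
    then have "insert {u, w} E \<in> \<G>" using ES that by (auto simp: \<G>_def simple_graphs_on_def Def_def)
    from Emax[OF this] show False using n fE by simp
  qed
  have "Def = {}"
  proof (rule ccontr)
    assume "Def \<noteq> {}"
    then obtain u where u: "u \<in> Def" by blast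
    then have uV: "u \<in> V" by (auto simp: Def_def)
    have deficit: "(\<Sum>i\<in>V. D i) = 2 * card E + (\<Sum>i\<in>Def. D i - degree_of E i)"
    proof -
      have "(\<Sum>i\<in>V. D i) = (\<Sum>i\<in>V. degree_of E i + (D i - degree_of E i))"
        using ED by (intro sum.cong) auto
      also have "\<dots> = 2 * card E + (\<Sum>i\<in>V. D i - degree_of E i)"
        by (simp add: sum.distrib handshake[OF V ES])
      also have "(\<Sum>i\<in>V. D i - degree_of E i) = (\<Sum>i\<in>Def. D i - degree_of E i)"
        using V by (intro sum.mono_neutral_right) (auto simp: Def_def)
      finally show ?thesis .
    qed
    have "Def \<subseteq> insert u (neighbours E u)" using Def_clique u by (auto simp: neighbours_def)
    moreover have fN: "finite (neighbours E u)"
      using neighbours_subset[OF ES] V by (rule finite_subset)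
    ultimately have "card Def \<le> Suc (card (neighbours E u))"
      by (auto simp: card_insert_if split: if_splits dest!: card_mono[rotated])
    then have "card Def \<le> \<Delta> + 1"
      using card_neighbours[OF ES, of u] ED[OF uV] deg[OF uV] by simp
    moreover have "(\<Sum>i\<in>Def. D i - degree_of E i) \<le> of_nat (card Def) * \<Delta>"
      using deg by (intro sum_bounded_above) (auto simp: Def_def intro: le_trans[OF diff_le_self])
    ultimately have "(\<Sum>i\<in>Def. D i - degree_of E i) \<le> \<Delta> * (\<Delta> + 1)"
      by (metis (no_types, lifting) le_trans mult.commute mult_le_mono1 of_nat_id)
    with deficit large have big: "2 * (\<Delta> * (\<Delta> + 1)) < 2 * card E" by simp
    obtain w where w: "w \<in> Def" "w = u \<Longrightarrow> degree_of E u + 2 \<le> D u"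
    proof (cases "Def = {u}")
      case True
      have "even (D u - degree_of E u)" using even deficit True by simp
      moreover have "D u - degree_of E u > 0" using u by (simp add: Def_def)
      ultimately have "D u - degree_of E u \<ge> 2" by presburger
      then show ?thesis using that[of u] u by simp
    next
      case False
      then show ?thesis using u that by blast
    qed
    have wV: "w \<in> V" using w by (auto simp: Def_def)
    define far where "far = {(x, y). {x, y} \<in> E \<and> x \<notin> insert u (neighbours E u)
        \<and> y \<notin> insert w (neighbours E w)}"
    have "2 * card E \<le> card far + 2 * (\<Delta> * (\<Delta> + 1))"
      unfolding far_def using ED deg uV wV by (intro card_far_pairs[OF V ES]) (auto intro: le_trans)
    with big have "card far \<noteq> 0" by linarith
    then have "far \<noteq> {}" by auto
    then obtain x y where "(x, y) \<in> far" by auto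
    then have xy: "{x, y} \<in> E" "{u, x} \<notin> E" "{w, y} \<notin> E" "x \<noteq> u" "y \<noteq> w"
      by (auto simp: neighbours_def far_def)
    have xy': "x \<noteq> y" "x \<in> V" "y \<in> V" using simple_graph_edge[OF ES xy(1)] by auto
    have "{u, x} \<noteq> {w, y}"
      using Def_clique[OF u w(1)] xy xy' by (auto simp: doubleton_eq_iff)
    note sw = degree_of_switch[OF fE xy(1) xy'(1) xy(2-5) this]
    let ?E = "insert {u, x} (insert {w, y} (E - {{x, y}}))"
    have "degree_of ?E i \<le> D i" if "i \<in> V" for i
      unfolding sw using ED[OF that] u w by (auto simp: Def_def)
    then have "?E \<in> \<G>" using ES uV wV xy xy' by (auto simp: \<G>_def simple_graphs_on_def)
    then have "card ?E \<le> card E" by (rule Emax)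
    moreover have "card ?E = Suc (Suc (card (E - {{x, y}})))"
      using xy \<open>{u, x} \<noteq> {w, y}\<close> fE by simp
    moreover have "card E = Suc (card (E - {{x, y}}))" by (rule card.remove[OF fE xy(1)])
    ultimately show False by simp
  qed
  then have "E \<in> extensions V D {}"
    using ES ED by (force simp: extensions_def Def_def)
  then show ?thesis by blast
qed

section \<open>Exploring a component\<close>

text \<open>Averaging over the hidden edges at \<open>u\<close>: every graph in \<open>\<A>\<close> has the same number of them.
  It is applied to all extensions of \<open>F\<close> and to those in which the component of \<open>v\<close> is
  large.\<close>

lemma sum_card_reveal:
  assumes V: "finite V" and u: "u \<in> V" and A: "\<A> \<subseteq> extensions V D F"
  shows "(\<Sum>w\<in>{w \<in> V. w \<noteq> u \<and> {u, w} \<notin> F}. card {E \<in> \<A>. {u, w} \<in> E})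
    = (D u - degree_of F u) * card \<A>"
proof -
  let ?W = "{w \<in> V. w \<noteq> u \<and> {u, w} \<notin> F}"
  have fA: "finite \<A>" using A finite_extensions[OF V] by (rule finite_subset)
  have "(\<Sum>w\<in>?W. card {E \<in> \<A>. {u, w} \<in> E}) = (\<Sum>w\<in>?W. \<Sum>E\<in>\<A>. of_bool ({u, w} \<in> E))"
    using fA by (simp add: Int_def)
  also have "\<dots> = (\<Sum>E\<in>\<A>. \<Sum>w\<in>?W. of_bool ({u, w} \<in> E))" by (rule sum.swap)
  also have "\<dots> = (\<Sum>E\<in>\<A>. D u - degree_of F u)"
  proof (rule sum.cong)
    fix E assume "E \<in> \<A>"
    then have E: "E \<in> extensions V D F" using A by auto
    then have ES: "E \<in> simple_graphs_on V" and EF: "E - F \<in> simple_graphs_on V"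
      by (auto simp: extensions_def intro: simple_graphs_on_subset)
    have "(\<Sum>w\<in>?W. of_bool ({u, w} \<in> E)) = card (?W \<inter> {w. {u, w} \<in> E})"
      using V by simp
    also have "?W \<inter> {w. {u, w} \<in> E} = neighbours (E - F) u"
      using ES by (auto simp: neighbours_def dest: simple_graph_edge)
    also have "card \<dots> = D u - degree_of F u"
      using E u simple_graph_finite[OF V ES]
      by (simp add: card_neighbours[OF EF] degree_of_Diff extensions_def)
    finally show "(\<Sum>w\<in>?W. of_bool ({u, w} \<in> E)) = D u - degree_of F u" .
  qed simp
  finally show ?thesis by simp
qed

text \<open>When no vertex of \<open>A\<close> has a hidden edge left, no edge leaves \<open>A\<close> and the exploration has
  ended.\<close>

lemma card_component_le:
  assumes E: "E \<in> extensions V D F" and V: "finite V" and F: "\<Union>F \<subseteq> A" and A: "A \<subseteq> V" "v \<in> A"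
    and sat: "\<And>a. a \<in> A \<Longrightarrow> D a \<le> degree_of F a"
  shows "card (component_of_vertex V E v) \<le> card A"
proof -
  have fE: "finite E" using E V by (auto simp: extensions_def intro: simple_graph_finite)
  have FE: "F \<subseteq> E" using E by (auto simp: extensions_def)
  have edge: "e \<in> F" if "a \<in> A" "a \<in> e" "e \<in> E" for a e
  proof -
    have "degree_of E a = D a" using E A that by (auto simp: extensions_def)
    then have "card {e \<in> E. a \<in> e} \<le> card {e \<in> F. a \<in> e}"
      using sat[OF that(1)] by (simp add: degree_of_def)
    then have "{e \<in> F. a \<in> e} = {e \<in> E. a \<in> e}"
      using fE FE by (intro card_seteq) auto
    then show ?thesis using that by auto
  qed
  have "w \<in> A" if "(v, w) \<in> {(x, y). {x, y} \<in> E}\<^sup>*" for w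
    using that
  proof induction
    case base
    then show ?case using A by simp
  next
    case (step y z)
    then have "{y, z} \<in> F" using edge[of y "{y, z}"] by auto
    then show ?case using F by auto
  qed
  then have "component_of_vertex V E v \<subseteq> A" by (auto simp: component_of_vertex_def)
  then show ?thesis using A V by (meson card_mono finite_subset)
qed

text \<open>One step of the supermartingale. The factor attached to \<open>w\<close> is \<open>exp\<close> of \<open>\<theta>\<close> times the change
  in the number of boundary half-edges: \<open>- 2\<close> if \<open>w\<close> is already explored and
  \<open>- 1 + (D w - 1)\<close> otherwise.\<close>

lemma exploration_step:
  fixes \<theta> L q :: real
  assumes V: "finite V" and u: "u \<in> A" and A: "A \<subseteq> V"
    and deg: "\<And>i. i \<in> V \<Longrightarrow> 0 < D i \<and> D i \<le> \<Delta>"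
    and th: "\<theta> \<ge> 0" and L: "L > 0" "L \<le> real (\<Sum>i\<in>V. D i) - 2 * real (card F) - 2 * (\<Delta> * (\<Delta> + 1))"
    and q: "exp (- \<theta>) * (1 + (\<Sum>w\<in>V. real (D w) * (exp (\<theta> * (D w - 1)) - 1)) / L) \<le> q"
  shows "(\<Sum>w\<in>{w \<in> V. w \<noteq> u \<and> {u, w} \<notin> F}. real (card (extensions V D (insert {u, w} F)))
      * (exp (- \<theta>) * (if w \<in> A then exp (- \<theta>) else exp (\<theta> * (D w - 1)))))
    \<le> q * (real (D u - degree_of F u) * real (card (extensions V D F)))"
proof -
  let ?W = "{w \<in> V. w \<noteq> u \<and> {u, w} \<notin> F}"
  let ?c = "\<lambda>w. real (card (extensions V D (insert {u, w} F)))"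
  let ?G = "real (card (extensions V D F))"
  let ?r = "real (D u - degree_of F u)"
  let ?x = "\<lambda>w. exp (\<theta> * (D w - 1)) - 1"
  have uV: "u \<in> V" using u A by auto
  have x0: "?x w \<ge> 0" if "w \<in> V" for w using th deg[OF that] by simp
  have sumc: "(\<Sum>w\<in>?W. ?c w) = ?r * ?G"
  proof -
    have "{E \<in> extensions V D F. {u, w} \<in> E} = extensions V D (insert {u, w} F)" for w
      by (auto simp: extensions_def)
    then show ?thesis
      using sum_card_reveal[OF V uV, of "extensions V D F" D F] by (simp flip: of_nat_sum of_nat_mult)
  qed
  have cw: "?c w \<le> ?r * ?G * D w / L" if w: "w \<in> ?W" for w
  proof -
    have "?c w * real (\<Sum>i\<in>V. D i) \<le> ?c w * (2 * real (card F) + 2 * (\<Delta> * (\<Delta> + 1)))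
        + ?G * (?r * real (D w - degree_of F w))"
    proof -
      have "u \<noteq> w" "w \<in> V" "{u, w} \<notin> F" using w by auto
      from of_nat_mono[OF switching[OF V uV this(2,1,3), of D \<Delta>], where 'a = real] deg show ?thesis
        by (simp only: of_nat_mult of_nat_add of_nat_numeral of_nat_1)
    qed
    then have "?c w * (real (\<Sum>i\<in>V. D i) - 2 * real (card F) - 2 * (\<Delta> * (\<Delta> + 1)))
        \<le> ?G * (?r * real (D w - degree_of F w))" by (simp add: algebra_simps)
    moreover have "?c w * L \<le> ?c w * (real (\<Sum>i\<in>V. D i) - 2 * real (card F) - 2 * (\<Delta> * (\<Delta> + 1)))"
      using L(2) by (rule mult_left_mono) simp
    moreover have "?G * (?r * real (D w - degree_of F w)) \<le> ?G * (?r * D w)"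
      by (intro mult_left_mono) auto
    ultimately have "?c w * L \<le> ?r * ?G * D w" by (simp add: mult_ac)
    then show ?thesis using L(1) by (simp add: pos_le_divide_eq)
  qed
  have "(\<Sum>w\<in>?W. ?c w * (if w \<in> A then exp (- \<theta>) else exp (\<theta> * (D w - 1))))
      \<le> (\<Sum>w\<in>?W. ?c w + ?r * ?G * (D w * ?x w / L))"
  proof (rule sum_mono)
    fix w assume w: "w \<in> ?W"
    have "?c w * (if w \<in> A then exp (- \<theta>) else exp (\<theta> * (D w - 1))) \<le> ?c w * (1 + ?x w)"
    proof (rule mult_left_mono)
      have "- \<theta> \<le> \<theta> * real (D w - 1)" 
        using th mult_nonneg_nonneg[OF th, of "real (D w - 1)"] by linarith
      then show "(if w \<in> A then exp (- \<theta>) else exp (\<theta> * (D w - 1))) \<le> 1 + ?x w" by simp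
    qed simp
    also have "\<dots> = ?c w + ?c w * ?x w" by (simp add: algebra_simps)
    also have "?c w * ?x w \<le> (?r * ?G * D w / L) * ?x w"
      using cw[OF w] x0[of w] w by (intro mult_right_mono) auto
    finally show "?c w * (if w \<in> A then exp (- \<theta>) else exp (\<theta> * (D w - 1)))
        \<le> ?c w + ?r * ?G * (D w * ?x w / L)" by (simp add: mult_ac)
  qed
  also have "\<dots> = ?r * ?G * (1 + (\<Sum>w\<in>?W. D w * ?x w / L))"
    by (simp add: sum.distrib sumc sum_distrib_left distrib_left)
  also have "\<dots> \<le> ?r * ?G * (1 + (\<Sum>w\<in>V. D w * ?x w / L))"
    using V x0 L(1) by (intro mult_left_mono add_left_mono sum_mono2) auto
  finally have "exp (- \<theta>) * (\<Sum>w\<in>?W. ?c w * (if w \<in> A then exp (- \<theta>) else exp (\<theta> * (D w - 1))))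
      \<le> exp (- \<theta>) * (?r * ?G * (1 + (\<Sum>w\<in>V. D w * ?x w / L)))"
    by (rule mult_left_mono) simp
  also have "\<dots> = (exp (- \<theta>) * (1 + (\<Sum>w\<in>V. D w * ?x w) / L)) * (?r * ?G)"
    by (simp add: sum_divide_distrib mult_ac)
  also have "\<dots> \<le> q * (?r * ?G)" using q by (rule mult_right_mono) simp
  finally show ?thesis by (simp add: sum_distrib_left mult_ac)
qed

text \<open>The number of boundary half-edges of the explored set \<open>A\<close>. It is real-valued so that the
  change caused by a revealed edge is exact even if \<open>F\<close> exceeds the degrees \<open>D\<close>.\<close>

definition residual :: "('a \<Rightarrow> nat) \<Rightarrow> 'a set set \<Rightarrow> 'a set \<Rightarrow> real" where
  "residual D F A = (\<Sum>a\<in>A. real (D a) - real (degree_of F a))"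

lemma residual_reveal:
  assumes fin: "finite F" "finite A" and F: "\<Union>F \<subseteq> A" and u: "u \<in> A" "w \<noteq> u" "{u, w} \<notin> F"
  shows "residual D (insert {u, w} F) (insert w A)
    = residual D F A + (if w \<in> A then - 2 else real (D w) - 2)"
proof -
  let ?F = "insert {u, w} F"
  have dF: "degree_of ?F a = degree_of F a + of_bool (a \<in> {u, w})" for a
    using fin u by (intro degree_of_insert) auto
  have "(\<Sum>a\<in>A. of_bool (a \<in> {u, w})) = real (card (A \<inter> {u, w}))"
    using fin by (subst sum_of_bool_eq) (simp_all only: Collect_mem_eq)
  then have sp: "(\<Sum>a\<in>A. real (D a) - real (degree_of ?F a))
      = residual D F A - real (card (A \<inter> {u, w}))"
    unfolding dF residual_def of_nat_add of_nat_of_bool sum_subtractf sum.distrib by linarith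
  show ?thesis
  proof (cases "w \<in> A")
    case True
    then have "A \<inter> {u, w} = {u, w}" "insert w A = A" using u by auto
    moreover have "card {u, w} = 2" using u by (simp add: card_insert_if)
    ultimately show ?thesis using sp True by (simp only: residual_def if_True of_nat_numeral diff_conv_add_uminus)
  next
    case False
    then have "A \<inter> {u, w} = {u}" using u by auto
    moreover have "{e \<in> F. w \<in> e} = {}" using False F by auto
    then have "degree_of F w = 0" by (simp only: degree_of_def card.empty)
    then have "degree_of ?F w = 1" unfolding dF by simp
    moreover have "residual D ?F (insert w A)
        = real (D w) - real (degree_of ?F w) + (\<Sum>a\<in>A. real (D a) - real (degree_of ?F a))"
      unfolding residual_def using False fin by (intro sum.insert) auto
    ultimately show ?thesis using False sp by simp
  qed
qed

text \<open>The induction runs over the number of edges still to be revealed before the stopping time \<open>k\<close>.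
  If the boundary is empty, the component lies in \<open>A\<close>, which has at most \<open>card F + 1\<close>
  vertices, and no graph is bad; if \<open>k\<close> edges are revealed, the bound is at least the number of
  all extensions. Otherwise a hidden edge at some boundary vertex \<open>u\<close> is revealed, and averaging
  over its other end multiplies the bound by at most \<open>q\<close>.\<close>

lemma exploration:
  fixes \<theta> L q :: real
  assumes V: "finite V" and deg: "\<And>i. i \<in> V \<Longrightarrow> 0 < D i \<and> D i \<le> \<Delta>"
    and th: "\<theta> \<ge> 0" and L: "L > 0" "L \<le> real (\<Sum>i\<in>V. D i) - 2 * real k - 2 * (\<Delta> * (\<Delta> + 1))"
    and q: "exp (- \<theta>) * (1 + (\<Sum>w\<in>V. real (D w) * (exp (\<theta> * (D w - 1)) - 1)) / L) \<le> q"
    and F: "F \<in> simple_graphs_on V" "\<Union>F \<subseteq> A" and A: "A \<subseteq> V" "v \<in> A"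
    and cards: "card A \<le> card F + 1" "card F \<le> k"
  shows "real (card {E \<in> extensions V D F. k < card (component_of_vertex V E v)})
    \<le> exp (\<theta> * residual D F A) * q ^ (k - card F) * real (card (extensions V D F))"
  using F A cards
proof (induction "k - card F" arbitrary: F A)
  case (0 F A)
  show ?case
  proof (cases "extensions V D F = {}")
    case False
    then obtain E where "E \<in> extensions V D F" by blast
    then have "degree_of F a \<le> D a" if "a \<in> A" for a
      using degree_of_mono[of E F a] simple_graph_finite[OF V, of E] that 0 by (auto simp: extensions_def)
    then have "residual D F A \<ge> 0" unfolding residual_def by (intro sum_nonneg) auto
    then have "1 \<le> exp (\<theta> * residual D F A)" using th by simp
    moreover have "real (card {E \<in> extensions V D F. k < card (component_of_vertex V E v)})
      \<le> 1 * real (card (extensions V D F))"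
      using finite_extensions[OF V, of D F] by (auto intro: card_mono)
    moreover have "1 * real (card (extensions V D F))
      \<le> exp (\<theta> * residual D F A) * real (card (extensions V D F))"
      using \<open>1 \<le> exp (\<theta> * residual D F A)\<close> by (rule mult_right_mono) simp
    ultimately show ?thesis using 0(1) by simp
  qed simp
next
  case (Suc m F A)
  let ?bad = "\<lambda>F. {E \<in> extensions V D F. k < card (component_of_vertex V E v)}"
  have fF: "finite F" using V Suc.prems(1) by (rule simple_graph_finite)
  have fA: "finite A" using V Suc.prems(3) by (rule finite_subset[rotated])
  have lt: "card F < k" using Suc.hyps(2) by simp
  have L': "L \<le> real (\<Sum>i\<in>V. D i) - 2 * real (card F) - 2 * (\<Delta> * (\<Delta> + 1))" using L(2) lt by linarith
  have q0: "q \<ge> 0"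
  proof (rule order_trans[OF _ q])
    have "exp (\<theta> * (D w - 1)) - 1 \<ge> 0" if "w \<in> V" for w using th deg[OF that] by simp
    then show "0 \<le> exp (- \<theta>) * (1 + (\<Sum>w\<in>V. real (D w) * (exp (\<theta> * (D w - 1)) - 1)) / L)"
      using L(1) by (intro mult_nonneg_nonneg add_nonneg_nonneg divide_nonneg_nonneg sum_nonneg) auto
  qed
  show ?case
  proof (cases "\<exists>u\<in>A. degree_of F u < D u")
    case False
    have "?bad F = {}"
    proof (rule ccontr)
      assume "?bad F \<noteq> {}"
      then obtain E where E: "E \<in> extensions V D F" "k < card (component_of_vertex V E v)" by blast
      have "card (component_of_vertex V E v) \<le> card A"
        using False Suc.prems by (intro card_component_le[OF E(1) V]) (auto simp: not_less)
      then show False using E(2) Suc.prems lt by simp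
    qed
    then show ?thesis using q0 by (simp only:) simp
  next
    case True
    then obtain u where u: "u \<in> A" "degree_of F u < D u" by blast
    then have uV: "u \<in> V" using Suc.prems by auto
    let ?W = "{w \<in> V. w \<noteq> u \<and> {u, w} \<notin> F}"
    let ?r = "real (D u - degree_of F u)"
    let ?f = "\<lambda>w. exp (- \<theta>) * (if w \<in> A then exp (- \<theta>) else exp (\<theta> * (D w - 1)))"
    let ?K = "exp (\<theta> * residual D F A) * q ^ m"
    have step: "real (card (?bad (insert {u, w} F))) \<le> ?K * (real (card (extensions V D (insert {u, w} F))) * ?f w)"
      if w: "w \<in> ?W" for w
    proof -
      let ?F = "insert {u, w} F" and ?A = "insert w A"
      have cF: "card ?F = Suc (card F)" using fF w by simp
      have FS: "?F \<in> simple_graphs_on V" using Suc.prems(1) uV w by (auto simp: simple_graphs_on_def)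
      have "real (card (?bad ?F)) \<le> exp (\<theta> * residual D ?F ?A) * q ^ (k - card ?F)
          * real (card (extensions V D ?F))"
        by (rule Suc.hyps(1)) (use Suc.hyps(2) Suc.prems FS cF u w lt fA in \<open>auto simp: card_insert_if\<close>)
      moreover have "exp (\<theta> * residual D ?F ?A) = exp (\<theta> * residual D F A) * ?f w"
      proof -
        have "\<theta> * residual D ?F ?A
            = \<theta> * residual D F A + (- \<theta> + (if w \<in> A then - \<theta> else \<theta> * real (D w - 1)))"
          using residual_reveal[OF fF fA Suc.prems(2) u(1), of w D] w deg[of w]
          by (simp add: algebra_simps of_nat_diff)
        then show ?thesis by (simp only: exp_add if_distrib[of exp])
      qed
      moreover have "k - card ?F = m" using cF Suc.hyps(2) by simp
      ultimately show ?thesis by (simp add: mult_ac)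
    qed
    have "?r * real (card (?bad F)) = (\<Sum>w\<in>?W. real (card (?bad (insert {u, w} F))))"
    proof -
      have "{E \<in> ?bad F. {u, w} \<in> E} = ?bad (insert {u, w} F)" for w
        by (auto simp: extensions_def)
      then show ?thesis
        using sum_card_reveal[OF V uV, of "?bad F" D F] by (simp flip: of_nat_sum of_nat_mult)
    qed
    also have "\<dots> \<le> (\<Sum>w\<in>?W. ?K * (real (card (extensions V D (insert {u, w} F))) * ?f w))"
      by (rule sum_mono) (rule step)
    also have "\<dots> = ?K * (\<Sum>w\<in>?W. real (card (extensions V D (insert {u, w} F))) * ?f w)"
      by (simp add: sum_distrib_left)
    also have "\<dots> \<le> ?K * (q * (?r * real (card (extensions V D F))))"
      using exploration_step[OF V u(1) Suc.prems(3) deg th L(1) L' q] q0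
      by (intro mult_left_mono) auto
    finally have "?r * real (card (?bad F)) \<le> ?r * (?K * q * real (card (extensions V D F)))"
      by (simp add: mult_ac)
    moreover have "?r > 0" using u by simp
    ultimately have "real (card (?bad F)) \<le> ?K * q * real (card (extensions V D F))"
      by (simp only: mult_le_cancel_left_pos)
    moreover have "q ^ (k - card F) = q ^ m * q" unfolding Suc.hyps(2)[symmetric] by simp
    ultimately show ?thesis by (simp only: mult.assoc)
  qed
qed

section \<open>Subcritical drift and the tail of the largest component\<close>

text \<open>The subcritical drift. On the range \<open>\<theta> * (D w - 1) \<le> \<tau> \<le> 1\<close> the exponential is linear up to
  the factor \<open>1 + \<tau>\<close>, so the sum is about \<open>\<theta>\<close> times the sum of \<open>D w * (D w - 1)\<close>,
  the numerator of the degree ratio.\<close>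

lemma decay_bound:
  fixes \<theta> L \<delta> :: real
  assumes deg: "\<And>i. i \<in> V \<Longrightarrow> D i \<le> \<Delta>" and th: "\<theta> \<ge> 0" "\<theta> * real \<Delta> \<le> \<tau>" "\<tau> \<le> 1" and L: "L > 0"
    and sub: "(1 + \<tau>) * real (\<Sum>i\<in>V. D i * (D i - 1)) \<le> (1 - \<delta>) * L"
  shows "exp (- \<theta>) * (1 + (\<Sum>w\<in>V. real (D w) * (exp (\<theta> * (D w - 1)) - 1)) / L) \<le> exp (- \<theta> * \<delta>)"
proof -
  have "(\<Sum>w\<in>V. real (D w) * (exp (\<theta> * (D w - 1)) - 1))
      \<le> (\<Sum>w\<in>V. \<theta> * (1 + \<tau>) * real (D w * (D w - 1)))"
  proof (rule sum_mono)
    fix w assume w: "w \<in> V"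
    let ?x = "\<theta> * real (D w - 1)"
    have "real (D w - 1) \<le> real \<Delta>" using deg[OF w] by simp
    then have x: "0 \<le> ?x" "?x \<le> \<tau>"
      using th mult_left_mono[of "real (D w - 1)" "real \<Delta>" \<theta>] by auto
    have "exp ?x - 1 \<le> ?x + ?x\<^sup>2" using exp_bound[of ?x] x th by simp
    also have "\<dots> \<le> ?x * (1 + \<tau>)"
      using mult_left_mono[OF x(2,1)] by (simp add: power2_eq_square distrib_left)
    finally have "real (D w) * (exp ?x - 1) \<le> real (D w) * (?x * (1 + \<tau>))"
      by (rule mult_left_mono) simp
    then show "real (D w) * (exp ?x - 1) \<le> \<theta> * (1 + \<tau>) * real (D w * (D w - 1))"
      by (simp add: mult_ac)
  qed
  also have "\<dots> = \<theta> * ((1 + \<tau>) * real (\<Sum>i\<in>V. D i * (D i - 1)))"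
    by (simp add: sum_distrib_left mult.assoc)
  also have "\<dots> \<le> \<theta> * ((1 - \<delta>) * L)" using sub th(1) by (rule mult_left_mono)
  finally have "(\<Sum>w\<in>V. real (D w) * (exp (\<theta> * (D w - 1)) - 1)) / L \<le> \<theta> * (1 - \<delta>)"
    using L by (simp add: pos_divide_le_eq mult.assoc)
  then have "1 + (\<Sum>w\<in>V. real (D w) * (exp (\<theta> * (D w - 1)) - 1)) / L \<le> exp (\<theta> * (1 - \<delta>))"
    using exp_ge_add_one_self[of "\<theta> * (1 - \<delta>)"] by linarith
  then have "exp (- \<theta>) * (1 + (\<Sum>w\<in>V. real (D w) * (exp (\<theta> * (D w - 1)) - 1)) / L)
      \<le> exp (- \<theta>) * exp (\<theta> * (1 - \<delta>))" by (rule mult_left_mono) simp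
  also have "\<dots> = exp (- \<theta> * \<delta>)" by (simp add: mult_exp_exp algebra_simps)
  finally show ?thesis .
qed

lemma card_large_component_le:
  fixes V :: "'a set" and \<theta> \<delta> \<tau> :: real
  assumes V: "finite V" "V \<noteq> {}" and deg: "\<And>i. i \<in> V \<Longrightarrow> 0 < D i \<and> D i \<le> \<Delta>"
    and th: "\<theta> \<ge> 0" "\<theta> * real \<Delta> \<le> \<tau>" "\<tau> \<le> 1"
    and L: "L > 0" "L \<le> real (\<Sum>i\<in>V. D i) - 2 * real k - real (2 * (\<Delta> * (\<Delta> + 1)))"
    and sub: "(1 + \<tau>) * real (\<Sum>i\<in>V. D i * (D i - 1)) \<le> (1 - \<delta>) * L"
  shows "real (card {E \<in> extensions V D {}. k < largest_component_size V E})
    \<le> card V * exp (\<tau> - \<theta> * \<delta> * k) * real (card (extensions V D {}))"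
proof -
  let ?G = "extensions V D {}"
  let ?bad = "\<lambda>v. {E \<in> ?G. k < card (component_of_vertex V E v)}"
  have "{E \<in> ?G. k < largest_component_size V E} \<subseteq> (\<Union>v\<in>V. ?bad v)"
    using V by (auto simp: largest_component_size_def Max_gr_iff)
  then have "card {E \<in> ?G. k < largest_component_size V E} \<le> card (\<Union>v\<in>V. ?bad v)"
    using V finite_extensions[OF V(1), of D "{}"] by (intro card_mono) auto
  also have "\<dots> \<le> (\<Sum>v\<in>V. card (?bad v))" using V(1) by (rule card_UN_le)
  finally have "real (card {E \<in> ?G. k < largest_component_size V E}) \<le> (\<Sum>v\<in>V. real (card (?bad v)))"
    by (simp flip: of_nat_sum)
  also have "\<dots> \<le> of_nat (card V) * (exp (\<tau> - \<theta> * \<delta> * k) * real (card ?G))"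
  proof (rule sum_bounded_above)
    fix v assume v: "v \<in> V"
    have deg': "D i \<le> \<Delta>" if "i \<in> V" for i using deg[OF that] by simp
    have "real (card (?bad v)) \<le> exp (\<theta> * residual D {} {v}) * exp (- \<theta> * \<delta>) ^ (k - card ({} :: 'a set set)) * real (card ?G)"
      by (rule exploration[OF V(1) deg th(1) L decay_bound[OF deg' th L(1) sub]])
        (use v deg in \<open>auto simp: simple_graphs_on_def\<close>)
    moreover have "\<theta> * residual D {} {v} \<le> \<tau>"
    proof -
      have "residual D {} {v} \<le> real \<Delta>" using deg[OF v] by (simp add: residual_def degree_of_def)
      then show ?thesis using mult_left_mono[OF _ th(1)] th(2) by fastforce
    qed
    moreover have "exp (- \<theta> * \<delta>) ^ (k - card ({} :: 'a set set)) = exp (- (\<theta> * \<delta> * k))"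
      by (simp flip: exp_of_nat_mult add: mult_ac)
    ultimately show "real (card (?bad v)) \<le> exp (\<tau> - \<theta> * \<delta> * k) * real (card ?G)"
      by (smt (verit) exp_diff exp_minus_inverse exp_le_cancel_iff mult_right_mono exp_add
          of_nat_0_le_iff exp_ge_zero)
  qed
  finally show ?thesis by (simp add: mult.assoc)
qed

lemma prob_random_graph:
  "\<P>(E in random_graph n D. Q E)
    = card {E \<in> extensions {1..n} D {}. Q E} / card (extensions {1..n} D {})"
proof -
  have G: "graphs_with_degrees n D = extensions {1..n} D {}"
    by (simp add: graphs_with_degrees_def extensions_def)
  then have "finite (graphs_with_degrees n D)" by (simp add: finite_extensions)
  then show ?thesis unfolding random_graph_def
    by (subst measure_uniform_count_measure) (auto simp: G space_uniform_count_measure)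
qed

lemma prob_random_graph_le_1: "\<P>(E in random_graph n D. Q E) \<le> 1"
proof -
  have "card {E \<in> extensions {1..n} D {}. Q E} \<le> card (extensions {1..n} D {})"
    by (intro card_mono finite_extensions) auto
  then show ?thesis unfolding prob_random_graph by (simp add: divide_le_eq)
qed

lemma prob_random_graph_mono:
  assumes "\<And>E. P E \<Longrightarrow> Q E"
  shows "\<P>(E in random_graph n D. P E) \<le> \<P>(E in random_graph n D. Q E)"
proof -
  have "card {E \<in> extensions {1..n} D {}. P E} \<le> card {E \<in> extensions {1..n} D {}. Q E}"
    using assms finite_extensions[of "{1..n}" D "{}"] by (intro card_mono) auto
  then show ?thesis unfolding prob_random_graph by (intro divide_right_mono) auto
qed

lemma prob_component_ge:
  assumes V: "V = {1..n}" "n \<ge> 1" and deg: "\<And>i. i \<in> V \<Longrightarrow> 0 < D i \<and> D i \<le> \<Delta>"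
    and even: "even (\<Sum>i\<in>V. D i)" and large: "3 * (\<Delta> * (\<Delta> + 1)) < (\<Sum>i\<in>V. D i)"
    and th: "\<theta> \<ge> 0" "\<theta> * real \<Delta> \<le> \<tau>" "\<tau> \<le> 1"
    and L: "L > 0" "L \<le> real (\<Sum>i\<in>V. D i) - 2 * real k - real (2 * (\<Delta> * (\<Delta> + 1)))"
    and sub: "(1 + \<tau>) * real (\<Sum>i\<in>V. D i * (D i - 1)) \<le> (1 - \<delta>) * L"
  shows "1 - real n * exp (\<tau> - \<theta> * \<delta> * k)
    \<le> \<P>(E in random_graph n D. largest_component_size V E \<le> k)"
proof -
  let ?G = "extensions V D {}"
  have fV: "finite V" "V \<noteq> {}" "card V = n" using V by auto
  have fG: "finite ?G" using fV(1) by (rule finite_extensions)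
  have "?G \<noteq> {}" using deg by (intro extensions_nonempty[OF fV(1) even _ large]) auto
  then have G0: "real (card ?G) > 0" using fG by (simp add: card_gt_0_iff)
  have "?G = {E \<in> ?G. largest_component_size V E \<le> k} \<union> {E \<in> ?G. k < largest_component_size V E}" by auto
  then have "card ?G = card {E \<in> ?G. largest_component_size V E \<le> k}
      + card {E \<in> ?G. k < largest_component_size V E}"
    using fG by (subst card_Un_disjoint[symmetric]) auto
  then have "real (card ?G) \<le> real (card {E \<in> ?G. largest_component_size V E \<le> k})
      + real n * exp (\<tau> - \<theta> * \<delta> * k) * real (card ?G)"
    using card_large_component_le[OF fV(1,2) deg th L sub] unfolding fV(3) by linarith
  then have "(1 - real n * exp (\<tau> - \<theta> * \<delta> * k)) * real (card ?G)
      \<le> real (card {E \<in> ?G. largest_component_size V E \<le> k})"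
    by (simp add: algebra_simps)
  then show ?thesis unfolding prob_random_graph V(1)[symmetric] using G0
    by (simp add: pos_le_divide_eq)
qed

section \<open>Asymptotics\<close>

text \<open>A degree that occurs at all occurs with proportion at least \<open>1 / n\<close>.\<close>

lemma max_degree_bound:
  fixes c \<gamma> :: real
  assumes n: "n \<ge> 1" and i: "i \<in> {1..n}" "D i > 0" and c: "c > 0" and g: "\<gamma> > 0"
    and power_law: "degree_proportion n D (D i) \<le> c * real (D i) powr (- \<gamma>)"
  shows "real (D i) \<le> c powr (1 / \<gamma>) * real n powr (1 / \<gamma>)"
proof -
  have "card {k \<in> {1..n}. D k = D i} > 0" using i by (auto simp: card_gt_0_iff)
  then have "1 / real n \<le> degree_proportion n D (D i)"
    unfolding degree_proportion_def by (intro divide_right_mono) auto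
  also note power_law
  finally have "real (D i) powr \<gamma> \<le> c * real n"
    using n i by (simp add: powr_minus field_simps)
  then have "(real (D i) powr \<gamma>) powr (1 / \<gamma>) \<le> (c * real n) powr (1 / \<gamma>)"
    using g by (intro powr_mono2) auto
  then show ?thesis using g i c by (simp add: powr_powr powr_mult)
qed

text \<open>The left-hand side dominates \<open>2 * k + 2 * \<Delta> * (\<Delta> + 1)\<close>, the amount by which \<open>L\<close> falls short
  of the degree sum. It is \<open>o(n)\<close> because \<open>1 / \<gamma>\<close> is below \<open>1 / 3\<close>.\<close>

lemma error_small:
  fixes \<gamma> C K \<epsilon> :: real
  assumes "\<gamma> > 3" "C > 0" "K > 0" "\<epsilon> > 0"
  shows "\<forall>\<^sub>F n in sequentially. 2 * K * (real n powr (1 / \<gamma>) * ln (real n))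
    + 4 * (C * real n powr (1 / \<gamma>))\<^sup>2 \<le> \<epsilon> * real n"
proof -
  have "\<forall>\<^sub>F n in sequentially. 2 * K * (real n powr (1 / 3) * ln (real n))
    + 4 * (C * real n powr (1 / 3))\<^sup>2 \<le> \<epsilon> * real n"
    using assms by real_asymp
  then show ?thesis using eventually_ge_at_top[of 1]
  proof eventually_elim
    case (elim n)
    have "real n powr (1 / \<gamma>) \<le> real n powr (1 / 3)"
      using assms elim by (intro powr_mono) (auto simp: field_simps)
    then have "2 * K * (real n powr (1 / \<gamma>) * ln (real n)) + 4 * (C * real n powr (1 / \<gamma>))\<^sup>2
      \<le> 2 * K * (real n powr (1 / 3) * ln (real n)) + 4 * (C * real n powr (1 / 3))\<^sup>2"
      using assms elim by (intro add_mono mult_left_mono mult_right_mono power_mono) auto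
    then show ?case using elim by linarith
  qed
qed

text \<open>A constant multiple of \<open>n powr (1 / \<gamma>) * ln n\<close> already suffices. With \<open>\<theta> = \<tau> / (C * b n)\<close>
  the choice of \<open>K\<close> makes \<open>\<theta> * \<delta> * k\<close> equal to \<open>2 * ln n\<close> up to rounding, so that the union
  bound over \<open>n\<close> vertices leaves a failure probability \<open>O(1 / n)\<close>.\<close>

lemma largest_component_bound:
  fixes d :: "nat \<Rightarrow> nat \<Rightarrow> nat" and c \<gamma> :: real
  assumes d_bounds: "\<And>n i. n \<ge> 2 \<Longrightarrow> i \<in> {1..n} \<Longrightarrow> 0 < d n i \<and> d n i < n"
    and even_sum: "\<And>n. n \<ge> 2 \<Longrightarrow> even (\<Sum>i\<in>{1..n}. d n i)"
    and c_pos: "c > 0"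
    and gamma_gt: "\<gamma> > 3"
    and power_law: "\<And>n j. n \<ge> 2 \<Longrightarrow> 1 \<le> j \<Longrightarrow> j \<le> n - 1 \<Longrightarrow>
                      degree_proportion n (d n) j \<le> c * real j powr (- \<gamma>)"
    and subcritical: "limsup (\<lambda>n. ereal (degree_ratio n (d n))) < 1"
  obtains K where "(\<lambda>n. \<P>(E in random_graph n (d n). real (largest_component_size {1..n} E)
    \<le> K * (real n powr (1 / \<gamma>) * ln (real n)))) \<longlonglongrightarrow> 1"
proof -
  obtain z where z: "limsup (\<lambda>n. ereal (degree_ratio n (d n))) < ereal z" "ereal z < 1"
    using ereal_dense2[OF subcritical] by blast
  define \<rho> where "\<rho> = max z 0"
  have \<rho>: "0 \<le> \<rho>" "\<rho> < 1" using z by (auto simp: \<rho>_def)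
  have ratio: "\<forall>\<^sub>F n in sequentially. degree_ratio n (d n) < \<rho>"
    using Limsup_lessD[OF z(1)] by eventually_elim (auto simp: \<rho>_def)
  define \<tau> where "\<tau> = (1 - \<rho>) / 4"
  define \<delta> where "\<delta> = (1 - \<rho>) / 2"
  define C where "C = c powr (1 / \<gamma>) + 1"
  define K where "K = 2 * C / (\<tau> * \<delta>)"
  have pos: "0 < \<tau>" "\<tau> \<le> 1/4" "0 < \<delta>" "\<delta> < 1" "C > 1" using \<rho> c_pos by (auto simp: \<tau>_def \<delta>_def C_def)
  then have Kpos: "K > 0" by (simp add: K_def)
  define b where "b = (\<lambda>n. real n powr (1 / \<gamma>))"
  have err: "\<forall>\<^sub>F n in sequentially. 2 * K * (b n * ln (real n)) + 4 * (C * b n)\<^sup>2 \<le> \<tau> * real n"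
    unfolding b_def using gamma_gt pos Kpos by (intro error_small) auto
  have ge: "\<forall>\<^sub>F n in sequentially. 1 - exp 2 / real n \<le>
      \<P>(E in random_graph n (d n). real (largest_component_size {1..n} E) \<le> K * (b n * ln (real n)))"
    using ratio err eventually_ge_at_top[of 2]
  proof eventually_elim
    case (elim n)
    let ?V = "{1..n}"
    define \<Delta> where "\<Delta> = nat \<lfloor>C * b n\<rfloor>"
    define k where "k = nat \<lfloor>K * (b n * ln (real n))\<rfloor>"
    define \<theta> where "\<theta> = \<tau> / (C * b n)"
    define S where "S = real (\<Sum>i\<in>?V. d n i)"
    have b1: "b n \<ge> 1" unfolding b_def using elim(3) gamma_gt by (intro ge_one_powr_ge_zero) auto
    have ln0: "ln (real n) \<ge> 0" using elim(3) by simp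
    have Cb: "C * b n \<ge> 1" using pos b1 mult_mono[of 1 C 1 "b n"] by simp
    have D: "real \<Delta> \<le> C * b n" unfolding \<Delta>_def using Cb by simp
    have kk: "real k \<le> K * (b n * ln (real n))" "K * (b n * ln (real n)) - 1 \<le> real k"
    proof -
      have "0 \<le> K * (b n * ln (real n))" using Kpos b1 ln0 by simp
      then have "real k = of_int \<lfloor>K * (b n * ln (real n))\<rfloor>" by (simp add: k_def)
      then show "real k \<le> K * (b n * ln (real n))" "K * (b n * ln (real n)) - 1 \<le> real k"
        by linarith+
    qed
    have deg: "0 < d n i \<and> d n i \<le> \<Delta>" if i: "i \<in> ?V" for i
    proof -
      have d: "0 < d n i" "d n i < n" using d_bounds[OF elim(3) i] by auto
      have "real (d n i) \<le> c powr (1 / \<gamma>) * b n"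
        unfolding b_def using elim(3) i d c_pos gamma_gt power_law[OF elim(3), of "d n i"]
        by (intro max_degree_bound) auto
      also have "\<dots> \<le> C * b n" using b1 by (intro mult_right_mono) (auto simp: C_def)
      finally show ?thesis using d by (simp add: \<Delta>_def le_nat_floor)
    qed
    have Sn: "real n \<le> S"
    proof -
      have "(\<Sum>i\<in>?V. 1) \<le> (\<Sum>i\<in>?V. d n i)" using deg by (intro sum_mono) (auto simp: Suc_leI)
      then show ?thesis unfolding S_def by (simp del: of_nat_sum)
    qed
    have S0: "S > 0" using Sn elim(3) by simp
    have D2: "2 * (real \<Delta> * (real \<Delta> + 1)) \<le> 4 * (C * b n)\<^sup>2"
    proof -
      have "real \<Delta> * (real \<Delta> + 1) \<le> (C * b n) * (C * b n + C * b n)"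
        using D Cb by (intro mult_mono) auto
      also have "\<dots> = 2 * (C * b n)\<^sup>2" by (simp add: power2_eq_square)
      finally show ?thesis by simp
    qed
    have "\<tau> * real n \<le> \<tau> * S" using Sn pos by simp
    then have errS: "2 * real k + 2 * (real \<Delta> * (real \<Delta> + 1)) \<le> \<tau> * S"
      using elim(2) D2 kk(1) by linarith
    have "\<tau> * S \<le> 1/4 * S" using pos S0 by (intro mult_right_mono) auto
    then have "3 * (real \<Delta> * (real \<Delta> + 1)) < S" using errS S0 by linarith
    then have "real (3 * (\<Delta> * (\<Delta> + 1))) < real (\<Sum>i\<in>?V. d n i)" by (simp add: S_def algebra_simps)
    then have large: "3 * (\<Delta> * (\<Delta> + 1)) < (\<Sum>i\<in>?V. d n i)" by (simp only: of_nat_less_iff)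
    have th: "\<theta> \<ge> 0" "\<theta> * real \<Delta> \<le> \<tau>"
      using pos Cb D by (auto simp: \<theta>_def pos_divide_le_eq intro: mult_left_mono)
    have L: "S - \<tau> * S > 0" using S0 \<open>\<tau> * S \<le> 1/4 * S\<close> by simp
    have sub: "(1 + \<tau>) * real (\<Sum>i\<in>?V. d n i * (d n i - 1)) \<le> (1 - \<delta>) * (S - \<tau> * S)"
    proof -
      have "real (\<Sum>i\<in>?V. d n i * (d n i - 1)) \<le> \<rho> * S"
        using elim(1) S0 unfolding degree_ratio_def S_def[symmetric] by (simp add: pos_divide_less_eq)
      then have "(1 + \<tau>) * real (\<Sum>i\<in>?V. d n i * (d n i - 1)) \<le> (1 + \<tau>) * (\<rho> * S)"
        using pos by (intro mult_left_mono) auto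
      also have "\<dots> = ((1 + \<tau>) * \<rho>) * S" by simp
      also have "\<dots> \<le> ((1 - \<delta>) * (1 - \<tau>)) * S"
      proof (rule mult_right_mono)
        (* with the gap g = 1 - rho: delta = g / 2 and tau = g / 4 make the terms linear in g cancel *)
        have "(1 - \<delta>) * (1 - \<tau>) - (1 + \<tau>) * \<rho> = 3 / 8 * (1 - \<rho>)\<^sup>2"
          by (simp add: \<delta>_def \<tau>_def power2_eq_square field_simps)
        then show "(1 + \<tau>) * \<rho> \<le> (1 - \<delta>) * (1 - \<tau>)"
          using zero_le_power2[of "1 - \<rho>"] by linarith
      qed (use S0 in simp)
      finally show ?thesis by (simp add: algebra_simps)
    qed
    have "1 - real n * exp (\<tau> - \<theta> * \<delta> * k)
      \<le> \<P>(E in random_graph n (d n). largest_component_size ?V E \<le> k)"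
    proof (rule prob_component_ge[OF refl _ deg even_sum[OF elim(3)] large th _ L _ sub])
      have "S - \<tau> * S \<le> S - 2 * real k - real (2 * (\<Delta> * (\<Delta> + 1)))"
        using errS by (simp add: algebra_simps)
      then show "S - \<tau> * S
          \<le> real (\<Sum>i\<in>?V. d n i) - 2 * real k - real (2 * (\<Delta> * (\<Delta> + 1)))"
        by (simp only: S_def)
    qed (use elim(3) pos in auto)
    moreover have "real n * exp (\<tau> - \<theta> * \<delta> * k) \<le> exp 2 / real n"
    proof -
      have "\<theta> * \<delta> * (K * (b n * ln (real n)) - 1) \<le> \<theta> * \<delta> * k"
        using kk(2) th pos by (intro mult_left_mono) auto
      moreover have "\<theta> * \<delta> * (K * (b n * ln (real n))) = 2 * ln (real n)"
        using pos b1 by (simp add: \<theta>_def K_def field_simps)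
      moreover have "\<theta> \<le> \<tau>" unfolding \<theta>_def using pos Cb by (simp add: divide_le_eq)
      then have "\<theta> * \<delta> \<le> 1" using pos th mult_mono[of \<theta> 1 \<delta> 1] by simp
      ultimately have "\<tau> - \<theta> * \<delta> * k \<le> 2 + - ln (real n) + - ln (real n)"
        using pos by (simp add: right_diff_distrib)
      then have "exp (\<tau> - \<theta> * \<delta> * k) \<le> exp (2 + - ln (real n) + - ln (real n))" by simp
      also have "\<dots> = exp 2 / (real n * real n)"
        unfolding exp_add using elim(3) by (simp add: exp_minus field_simps)
      finally have "real n * exp (\<tau> - \<theta> * \<delta> * k) \<le> real n * (exp 2 / (real n * real n))"
        by (rule mult_left_mono) simp
      then show ?thesis using elim(3) by simp
    qed
    moreover have "\<P>(E in random_graph n (d n). largest_component_size ?V E \<le> k)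
      \<le> \<P>(E in random_graph n (d n). real (largest_component_size ?V E) \<le> K * (b n * ln (real n)))"
      using kk(1) by (intro prob_random_graph_mono) (meson of_nat_le_iff order_trans)
    ultimately show ?case by linarith
  qed
  have lim: "(\<lambda>n. 1 - exp 2 / real n) \<longlonglongrightarrow> 1" by real_asymp
  have "(\<lambda>n. \<P>(E in random_graph n (d n). real (largest_component_size {1..n} E)
    \<le> K * (b n * ln (real n)))) \<longlonglongrightarrow> 1"
    by (rule tendsto_sandwich[OF ge always_eventually lim tendsto_const])
      (intro allI prob_random_graph_le_1)
  then show thesis using that unfolding b_def by blast
qed

theorem mainTheorem1:
  fixes d :: "nat \<Rightarrow> nat \<Rightarrow> nat" and c \<gamma> :: real
  assumes d_bounds: "\<And>n i. n \<ge> 2 \<Longrightarrow> i \<in> {1..n} \<Longrightarrow> 0 < d n i \<and> d n i < n"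
    and even_sum: "\<And>n. n \<ge> 2 \<Longrightarrow> even (\<Sum>i\<in>{1..n}. d n i)"
    and c_pos: "c > 0"
    and gamma_gt: "\<gamma> > 3"
    and power_law: "\<And>n j. n \<ge> 2 \<Longrightarrow> 1 \<le> j \<Longrightarrow> j \<le> n - 1 \<Longrightarrow>
                      degree_proportion n (d n) j \<le> c * real j powr (- \<gamma>)"
    and subcritical: "limsup (\<lambda>n. ereal (degree_ratio n (d n))) < 1"
  shows "(\<forall>\<omega> :: nat \<Rightarrow> real. filterlim \<omega> at_top sequentially \<longrightarrow>
            (\<lambda>n. \<P>(E in random_graph n (d n).
                    real (largest_component_size {1..n} E)
                      \<le> \<omega> n * real n powr (1 / \<gamma>) * ln (real n))) \<longlonglongrightarrow> 1)
       \<and> bigO_in_prob (\<lambda>n. random_graph n (d n))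
            (\<lambda>n E. real (largest_component_size {1..n} E))
            (\<lambda>n. real n powr (1 / \<gamma>) * ln (real n))"
proof -
  let ?a = "\<lambda>n. real n powr (1 / \<gamma>) * ln (real n)"
  let ?X = "\<lambda>n E. real (largest_component_size {1..n} E)"
  obtain K where K: "(\<lambda>n. \<P>(E in random_graph n (d n). ?X n E \<le> K * ?a n)) \<longlonglongrightarrow> 1"
    using largest_component_bound[OF assms] by blast
  show ?thesis
  proof (intro conjI allI impI)
    fix \<omega> :: "nat \<Rightarrow> real" assume "filterlim \<omega> at_top sequentially"
    then have "\<forall>\<^sub>F n in sequentially. K \<le> \<omega> n" by (simp add: filterlim_at_top)
    then have "\<forall>\<^sub>F n in sequentially. \<P>(E in random_graph n (d n). ?X n E \<le> K * ?a n)
        \<le> \<P>(E in random_graph n (d n). ?X n E \<le> \<omega> n * real n powr (1 / \<gamma>) * ln (real n))"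
      using eventually_ge_at_top[of 1]
    proof eventually_elim
      case (elim n)
      then have "K * ?a n \<le> \<omega> n * ?a n" by (intro mult_right_mono) auto
      then show ?case by (intro prob_random_graph_mono) (simp add: mult.assoc)
    qed
    then show "(\<lambda>n. \<P>(E in random_graph n (d n). ?X n E \<le> \<omega> n * real n powr (1 / \<gamma>) * ln (real n)))
        \<longlonglongrightarrow> 1"
      by (rule tendsto_sandwich[OF _ always_eventually K tendsto_const])
        (intro allI prob_random_graph_le_1)
  next
    show "bigO_in_prob (\<lambda>n. random_graph n (d n)) ?X ?a"
      unfolding bigO_in_prob_def
    proof (intro allI impI exI)
      fix \<epsilon> :: real assume "\<epsilon> > 0"
      then have "\<forall>\<^sub>F n in sequentially. 1 - \<epsilon> < \<P>(E in random_graph n (d n). ?X n E \<le> K * ?a n)"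
        using order_tendstoD(1)[OF K, of "1 - \<epsilon>"] by simp
      then show "\<forall>\<^sub>F n in sequentially. 1 - \<epsilon> < \<P>(E in random_graph n (d n). \<bar>?X n E / ?a n\<bar> \<le> K)"
        using eventually_ge_at_top[of 2]
      proof eventually_elim
        case (elim n)
        then have "?a n > 0" by simp
        then have "\<P>(E in random_graph n (d n). ?X n E \<le> K * ?a n)
            \<le> \<P>(E in random_graph n (d n). \<bar>?X n E / ?a n\<bar> \<le> K)"
          by (intro prob_random_graph_mono) (simp add: pos_divide_le_eq)
        with elim show ?case by linarith
      qed
    qed
  qed
qed

end
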